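(* Let $k\ge 2$, let $\mathcal{X}$ be a set, let $\mathcal{Y}=\{1,\dots,k\}$, and let $\mathcal{P}\subseteq(\mathcal{X}\times\mathcal{Y})^\star$ be a pattern class. Then \[ \mathsf{opt}_{\operatorname{bandit}}^{\operatorname{adap}}(\mathcal{P}) \le 6k\cdot \mathsf{opt}_{\operatorname{full}}^{\operatorname{rand}}(\mathcal{P}). \]
   Context: A pattern is a finite sequence of examples $(x,y)\in\mathcal{X}\times\mathcal{Y}$; a pattern class is a nonempty set of patterns closed under taking subsequences. Online learning: in rounds $t=1,2,\dots$ the adversary presents $x_t\in\mathcal{X}$, the learner outputs a (possibly random) prediction $\hat y_t\in\mathcal{Y}$, and there is a true label $y_t$; a mistake occurs when $\hat y_t\ne y_t$. With full-information feedback the learner observes $y_t$ after each round; with bandit feedback it observes only whether $\hat y_t=y_t$. A learner maps the history of observations and the current instance to a distribution over $\mathcal{Y}$. A bandit history $(x_s,o_s,\hat y_s)_{s\le T}$, $o_s\in\{\text{correct},\text{incorrect}\}$, is realizable by $\mathcal{P}$ if there are labels $y_1,\dots,y_T$ with $y_s=\hat y_s$ exactly when $o_s=\text{correct}$ and $(x_1,y_1)\cdots(x_T,y_T)\in\mathcal{P}$. $\mathsf{opt}_{\operatorname{full}}^{\operatorname{rand}}(\mathcal{P})=\inf_{\text{learner}}\sup_{S\in\mathcal{P}}$ (expected number of mistakes of the learner on the sequence $S$ with full-information feedback). An adaptive adversary, in each round, chooses $x_t$ as a function of the history, then sees the learner's distribution $\pi^{(t)}$ for this round and chooses a distribution $\tau^{(t)}$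 on $\mathcal{Y}$ (as a function of the history, $x_t$, $\pi^{(t)}$); then $\hat y_t\sim\pi^{(t)}$ and $y_t\sim\tau^{(t)}$ are drawn and bandit feedback is given. It is consistent with $\mathcal{P}$ if whenever the history is realizable, for every $y$ in the support of $\tau^{(t)}$ the history extended by the round with instance $x_t$ and true label $y$ is still realizable. $\mathsf{opt}_{\operatorname{bandit}}^{\operatorname{adap}}(\mathcal{P})=\inf_{\text{learner}}\sup_{\text{adversary}}$ expected number of mistakes, the supremum over adaptive adversaries consistent with $\mathcal{P}$. *)

theory Defs
  imports "HOL-Probability.Probability" "HOL-Library.Sublist"
begin

text \<open>Labels are natural numbers; the label set is Y = {1..k}.
  A pattern is a list of examples (x, y).  A full history entry is (x, prediction, true label).
  A bandit history entry is (x, o, prediction) with o = True meaning "correct".\<close>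

definition pattern_class :: "('x \<times> nat) list set \<Rightarrow> bool" where
  "pattern_class P \<longleftrightarrow> P \<noteq> {} \<and> (\<forall>S\<in>P. \<forall>S'. subseq S' S \<longrightarrow> S' \<in> P)"

primrec full_mistakes ::
  "(('x \<times> nat \<times> nat) list \<Rightarrow> 'x \<Rightarrow> nat pmf) \<Rightarrow> ('x \<times> nat) list
     \<Rightarrow> ('x \<times> nat \<times> nat) list \<Rightarrow> ennreal" where
  "full_mistakes L [] = (\<lambda>h. 0)"
| "full_mistakes L (e # S) = (\<lambda>h.
     \<integral>\<^sup>+ yh. (if yh \<noteq> snd e then 1 else 0) + full_mistakes L S (h @ [(fst e, yh, snd e)])
       \<partial>measure_pmf (L h (fst e)))"

definition opt_full_rand :: "nat \<Rightarrow> ('x \<times> nat) list set \<Rightarrow> ennreal" where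
  "opt_full_rand k P =
     (INF L \<in> {L. \<forall>h x. set_pmf (L h x) \<subseteq> {1..k}}. SUP S \<in> P. full_mistakes L S [])"

definition bview :: "('x \<times> nat \<times> nat) list \<Rightarrow> ('x \<times> bool \<times> nat) list" where
  "bview h = map (\<lambda>(x, yh, y). (x, yh = y, yh)) h"

definition labels_fit :: "('x \<times> bool \<times> nat) list \<Rightarrow> nat list \<Rightarrow> bool" where
  "labels_fit H ys \<longleftrightarrow> length ys = length H \<and>
     (\<forall>i<length H. (ys ! i = snd (snd (H ! i))) \<longleftrightarrow> fst (snd (H ! i)))"

definition bandit_realizable :: "('x \<times> nat) list set \<Rightarrow> ('x \<times> bool \<times> nat) list \<Rightarrow> bool" where
  "bandit_realizable P H \<longleftrightarrow> (\<exists>ys. labels_fit H ys \<and> zip (map fst H) ys \<in> P)"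

definition extension_realizable ::
  "('x \<times> nat) list set \<Rightarrow> ('x \<times> bool \<times> nat) list \<Rightarrow> 'x \<Rightarrow> nat \<Rightarrow> bool" where
  "extension_realizable P H x y \<longleftrightarrow>
     (\<exists>ys. labels_fit H ys \<and> zip (map fst H) ys @ [(x, y)] \<in> P)"

text \<open>An adaptive adversary: AX chooses the next instance from the full history
  (None = the game ends), AT chooses the label distribution from the history,
  the instance and the learner's distribution.\<close>

definition adversary_consistent ::
  "('x \<times> nat) list set \<Rightarrow> (('x \<times> nat \<times> nat) list \<Rightarrow> 'x option)
     \<Rightarrow> (('x \<times> nat \<times> nat) list \<Rightarrow> 'x \<Rightarrow> nat pmf \<Rightarrow> nat pmf) \<Rightarrow> bool" where
  "adversary_consistent P AX AT \<longleftrightarrow>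
     (\<forall>h x \<pi>. AX h = Some x \<longrightarrow> bandit_realizable P (bview h) \<longrightarrow>
        (\<forall>y \<in> set_pmf (AT h x \<pi>). extension_realizable P (bview h) x y))"

primrec bandit_mistakes ::
  "(('x \<times> bool \<times> nat) list \<Rightarrow> 'x \<Rightarrow> nat pmf) \<Rightarrow> (('x \<times> nat \<times> nat) list \<Rightarrow> 'x option)
     \<Rightarrow> (('x \<times> nat \<times> nat) list \<Rightarrow> 'x \<Rightarrow> nat pmf \<Rightarrow> nat pmf) \<Rightarrow> nat
     \<Rightarrow> ('x \<times> nat \<times> nat) list \<Rightarrow> ennreal" where
  "bandit_mistakes L AX AT 0 = (\<lambda>h. 0)"
| "bandit_mistakes L AX AT (Suc T) = (\<lambda>h.
     (case AX h of
        None \<Rightarrow> 0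
      | Some x \<Rightarrow>
          \<integral>\<^sup>+ yh. \<integral>\<^sup>+ y. (if yh \<noteq> y then 1 else 0) + bandit_mistakes L AX AT T (h @ [(x, yh, y)])
            \<partial>measure_pmf (AT h x (L (bview h) x))
          \<partial>measure_pmf (L (bview h) x)))"

definition opt_bandit_adap :: "nat \<Rightarrow> ('x \<times> nat) list set \<Rightarrow> ennreal" where
  "opt_bandit_adap k P =
     (INF L \<in> {L. \<forall>H x. set_pmf (L H x) \<subseteq> {1..k}}.
        SUP A \<in> {(AX, AT). adversary_consistent P AX AT}.
          SUP T. bandit_mistakes L (fst A) (snd A) T [])"

end

theory Submission
  imports Defs
begin

text \<open>Averaging a full-information learner over its own predictions yields a predictor of the label
  distribution that depends on the labelled past only and loses at most m on every pattern of P.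
  Give a labelling of the bandit history the weight k to the power -3 times the loss of this
  predictor, and let W be the total weight of all labellings that fit the history, whether or not
  they lie in P.  As some fitting labelling does lie in P, W never falls below k to the power -3m;
  initially W = 1.
  The bandit learner guesses uniformly unless some label carries a share of at least threshold k
  of the weight, in which case it predicts that label.  In expectation ln W then drops in each
  round by at least rate k = ln k / (2k) times the probability of a mistake, so that at most
  3m ln k / rate k = 6km mistakes are expected.
  The weights need not sum up: appending an unknown label may multiply W by up to 1 + 1/k^2, but
  this is harmless since it happens only on mistakes.\<close>

section \<open>Averaging a full-information learner into a predictor\<close>

definition predictor_loss :: "(('x \<times> nat) list \<Rightarrow> 'x \<Rightarrow> nat pmf) \<Rightarrow> ('x \<times> nat) list \<Rightarrow> real" where
  "predictor_loss p S = (\<Sum>i<length S. 1 - pmf (p (take i S) (fst (S ! i))) (snd (S ! i)))"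

lemma predictor_loss_Nil [simp]: "predictor_loss p [] = 0"
  by (simp add: predictor_loss_def)

lemma predictor_loss_snoc:
  "predictor_loss p (S @ [(x, y)]) = predictor_loss p S + (1 - pmf (p S x) y)"
  by (simp add: predictor_loss_def nth_append)

lemma predictor_loss_nonneg: "predictor_loss p S \<ge> 0"
  unfolding predictor_loss_def by (intro sum_nonneg) (simp add: pmf_le_1)

text \<open>The law of the full history when \<open>L\<close> plays against the fixed sequence
  \<open>S\<close>. With \<open>foldl\<close>, appending an example to \<open>S\<close> adds one
  more draw.\<close>

definition history_pmf ::
  "(('x \<times> nat \<times> nat) list \<Rightarrow> 'x \<Rightarrow> nat pmf) \<Rightarrow> ('x \<times> nat) list \<Rightarrow> ('x \<times> nat \<times> nat) list pmf" where
  "history_pmf L S =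
     foldl (\<lambda>D (x, y). bind_pmf D (\<lambda>h. map_pmf (\<lambda>yh. h @ [(x, yh, y)]) (L h x))) (return_pmf []) S"

definition marginal_predictor ::
  "(('x \<times> nat \<times> nat) list \<Rightarrow> 'x \<Rightarrow> nat pmf) \<Rightarrow> ('x \<times> nat) list \<Rightarrow> 'x \<Rightarrow> nat pmf" where
  "marginal_predictor L S x = bind_pmf (history_pmf L S) (\<lambda>h. L h x)"

lemma nn_integral_neq_pmf:
  "(\<integral>\<^sup>+ z. (if z \<noteq> y then 1 else 0) \<partial>measure_pmf q) = ennreal (1 - pmf q y)"
proof -
  have "(\<integral>\<^sup>+ z. (if z \<noteq> y then 1 else 0) \<partial>measure_pmf q) = (\<integral>\<^sup>+ z. indicator (- {y}) z \<partial>measure_pmf q)"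
    by (intro nn_integral_cong) (auto split: split_indicator)
  also have "\<dots> = emeasure (measure_pmf q) (- {y})"
    by simp
  also have "\<dots> = ennreal (1 - pmf q y)"
    using measure_pmf.prob_compl[of "{y}" q]
    by (simp add: measure_pmf.emeasure_eq_measure Compl_eq_Diff_UNIV measure_pmf_single)
  finally show ?thesis .
qed

text \<open>By linearity of expectation only the marginal law of each prediction matters. The prefix
  \<open>S0\<close> carries the induction: a step moves the first example of \<open>S\<close> to the
  end of \<open>S0\<close>.\<close>

lemma full_mistakes_history_pmf:
  "(\<integral>\<^sup>+ h. full_mistakes L S h \<partial>measure_pmf (history_pmf L S0))
     + ennreal (predictor_loss (marginal_predictor L) S0)
   = ennreal (predictor_loss (marginal_predictor L) (S0 @ S))"
proof (induction S arbitrary: S0)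
  case Nil
  then show ?case by simp
next
  case (Cons e S)
  obtain x y where e: "e = (x, y)" by fastforce
  let ?p = "marginal_predictor L"
  have "(\<integral>\<^sup>+ h. full_mistakes L (e # S) h \<partial>measure_pmf (history_pmf L S0))
     = (\<integral>\<^sup>+ h. (\<integral>\<^sup>+ z. (if z \<noteq> y then 1 else 0) \<partial>measure_pmf (L h x)) \<partial>measure_pmf (history_pmf L S0))
     + (\<integral>\<^sup>+ h. (\<integral>\<^sup>+ z. full_mistakes L S (h @ [(x, z, y)]) \<partial>measure_pmf (L h x)) \<partial>measure_pmf (history_pmf L S0))"
    by (simp add: e nn_integral_add)
  also have "(\<integral>\<^sup>+ h. (\<integral>\<^sup>+ z. (if z \<noteq> y then 1 else 0) \<partial>measure_pmf (L h x)) \<partial>measure_pmf (history_pmf L S0))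
     = ennreal (1 - pmf (?p S0 x) y)"
    unfolding nn_integral_neq_pmf[symmetric] by (simp add: marginal_predictor_def)
  also have "(\<integral>\<^sup>+ h. (\<integral>\<^sup>+ z. full_mistakes L S (h @ [(x, z, y)]) \<partial>measure_pmf (L h x)) \<partial>measure_pmf (history_pmf L S0))
     = (\<integral>\<^sup>+ h. full_mistakes L S h \<partial>measure_pmf (history_pmf L (S0 @ [(x, y)])))"
    by (simp add: history_pmf_def)
  finally have "(\<integral>\<^sup>+ h. full_mistakes L (e # S) h \<partial>measure_pmf (history_pmf L S0))
       + ennreal (predictor_loss ?p S0)
     = (\<integral>\<^sup>+ h. full_mistakes L S h \<partial>measure_pmf (history_pmf L (S0 @ [(x, y)])))
       + ennreal (predictor_loss ?p (S0 @ [(x, y)]))"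
    by (simp add: predictor_loss_snoc predictor_loss_nonneg pmf_le_1 ennreal_plus add_ac)
  then show ?case
    using Cons.IH[of "S0 @ [(x, y)]"] by (simp add: e)
qed

lemma full_mistakes_eq_predictor_loss:
  "full_mistakes L S [] = ennreal (predictor_loss (marginal_predictor L) S)"
  using full_mistakes_history_pmf[of L "[]" S] by (simp add: history_pmf_def)

section \<open>Labellings that fit a bandit history, and their weight\<close>

text \<open>Incorrect rounds leave infinitely many natural numbers to \<open>labels_fit\<close>; the
  bound to \<open>{1..k}\<close> makes the sum over labellings finite.\<close>

definition fitting :: "nat \<Rightarrow> ('x \<times> bool \<times> nat) list \<Rightarrow> nat list set" where
  "fitting k H = {ys. labels_fit H ys \<and> set ys \<subseteq> {1..k}}"

lemma labels_fit_snoc: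
  "labels_fit (H @ [(x, c, z)]) (ys @ [y]) \<longleftrightarrow> labels_fit H ys \<and> (y = z \<longleftrightarrow> c)"
  unfolding labels_fit_def by (auto simp: nth_append less_Suc_eq)

lemma finite_fitting: "finite (fitting k H)"
  by (rule finite_subset[OF _ finite_lists_length_eq[of "{1..k}" "length H"]])
    (auto simp: fitting_def labels_fit_def)

lemma fitting_Nil [simp]: "fitting k [] = {[]}"
  by (auto simp: fitting_def labels_fit_def)

lemma fitting_snoc:
  "fitting k (H @ [(x, c, z)]) =
     (\<lambda>(ys, y). ys @ [y]) ` (fitting k H \<times> {y \<in> {1..k}. y = z \<longleftrightarrow> c})"
proof -
  have "ys \<in> (\<lambda>(ys, y). ys @ [y]) ` (fitting k H \<times> {y \<in> {1..k}. y = z \<longleftrightarrow> c})"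
    if "ys \<in> fitting k (H @ [(x, c, z)])" for ys
  proof (cases ys rule: rev_exhaust)
    case Nil
    with that show ?thesis by (simp add: fitting_def labels_fit_def)
  next
    case (snoc ys' y)
    with that show ?thesis
      by (auto simp: fitting_def labels_fit_snoc image_iff)
  qed
  then show ?thesis
    by (auto simp: fitting_def labels_fit_snoc)
qed

definition weight :: "nat \<Rightarrow> (('x \<times> nat) list \<Rightarrow> 'x \<Rightarrow> nat pmf) \<Rightarrow> ('x \<times> bool \<times> nat) list \<Rightarrow> real" where
  "weight k p H = (\<Sum>ys\<in>fitting k H. real k powr (- 3 * predictor_loss p (zip (map fst H) ys)))"

lemma weight_Nil [simp]: "k \<ge> 1 \<Longrightarrow> weight k p [] = 1"
  by (simp add: weight_def)

lemma weight_snoc: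
  "weight k p (H @ [(x, c, z)]) =
     (\<Sum>ys\<in>fitting k H. \<Sum>y\<in>{y \<in> {1..k}. y = z \<longleftrightarrow> c}.
        real k powr (- 3 * predictor_loss p (zip (map fst H) ys))
          * real k powr (- 3 * (1 - pmf (p (zip (map fst H) ys) x) y)))"
proof -
  have "weight k p (H @ [(x, c, z)]) =
     (\<Sum>(ys, y)\<in>fitting k H \<times> {y \<in> {1..k}. y = z \<longleftrightarrow> c}.
        real k powr (- 3 * predictor_loss p (zip (map fst (H @ [(x, c, z)])) (ys @ [y]))))"
    unfolding weight_def fitting_snoc
    by (subst sum.reindex) (auto simp: inj_on_def case_prod_unfold)
  also have "\<dots> = (\<Sum>(ys, y)\<in>fitting k H \<times> {y \<in> {1..k}. y = z \<longleftrightarrow> c}.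
        real k powr (- 3 * predictor_loss p (zip (map fst H) ys))
          * real k powr (- 3 * (1 - pmf (p (zip (map fst H) ys) x) y)))"
    by (intro sum.cong refl)
      (auto simp: fitting_def labels_fit_def predictor_loss_snoc powr_add[symmetric] algebra_simps)
  finally show ?thesis
    by (simp add: sum.cartesian_product)
qed

lemma weight_correct:
  assumes "z \<in> {1..k}"
  shows "weight k p (H @ [(x, True, z)]) =
     (\<Sum>ys\<in>fitting k H. real k powr (- 3 * predictor_loss p (zip (map fst H) ys))
          * real k powr (- 3 * (1 - pmf (p (zip (map fst H) ys) x) z)))"
proof -
  have "{y \<in> {1..k}. y = z \<longleftrightarrow> True} = {z}"
    using assms by auto
  then show ?thesis
    unfolding weight_snoc by simp
qed

text \<open>Ruling out \<open>z\<close> leaves the other labels, each contributing what it would if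
  it were confirmed. So \<open>weight k p (H @ [(x, True, y)])\<close> acts as the weight of label
  \<open>y\<close> from here on.\<close>

lemma weight_incorrect:
  "weight k p (H @ [(x, False, z)]) = (\<Sum>y\<in>{1..k} - {z}. weight k p (H @ [(x, True, y)]))"
proof -
  have "{y \<in> {1..k}. y = z \<longleftrightarrow> False} = {1..k} - {z}"
    by auto
  then show ?thesis
    by (simp add: weight_snoc[of k p H x False] weight_correct sum.swap[of _ "fitting k H"])
qed

lemma weight_correct_le:
  assumes "k \<ge> 1" "z \<in> {1..k}"
  shows "weight k p (H @ [(x, True, z)]) \<le> weight k p H"
  unfolding weight_correct[OF assms(2)] unfolding weight_def
proof (intro sum_mono)
  fix ys
  have "real k powr (- 3 * (1 - pmf (p (zip (map fst H) ys) x) z)) \<le> real k powr 0"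
    using assms(1) by (intro powr_mono) (auto simp: pmf_le_1)
  also have "real k powr 0 = 1"
    using assms(1) by simp
  finally show "real k powr (- 3 * predictor_loss p (zip (map fst H) ys))
      * real k powr (- 3 * (1 - pmf (p (zip (map fst H) ys) x) z))
      \<le> real k powr (- 3 * predictor_loss p (zip (map fst H) ys))"
    by (intro mult_left_le) auto
qed

lemma weight_correct_pos:
  assumes "z \<in> {1..k}" "weight k p H > 0"
  shows "weight k p (H @ [(x, True, z)]) > 0"
proof -
  have "fitting k H \<noteq> {}"
    using assms(2) by (auto simp: weight_def)
  then show ?thesis
    unfolding weight_correct[OF assms(1)] using assms(1)
    by (intro sum_pos finite_fitting) auto
qed

section \<open>Growth of the total weight in one round\<close>

text \<open>Convexity of \<open>exp\<close>: the left side, as a function of \<open>q\<close>, lies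
  below its chord over \<open>[0, 1]\<close>. The bound is linear in \<open>q\<close>, so it can be
  summed over labels.\<close>

lemma powr_minus_le_chord:
  fixes a q c :: real
  assumes "a > 0" "0 \<le> q" "q \<le> 1"
  shows "a powr (- c * (1 - q)) \<le> q + (1 - q) * a powr (- c)"
  using convex_onD[OF exp_convex, of "1 - q" 0 "- c * ln a"] assms
  by (simp add: powr_def algebra_simps)

text \<open>The chords add up to at most 1 plus \<open>k\<close> times their value at probability 0.
  The exponent 3 makes that excess \<open>k * k powr (-3) = 1 / k^2\<close>.\<close>

lemma sum_powr_pmf_le:
  assumes "k \<ge> 1"
  shows "(\<Sum>y\<in>{1..k}. real k powr (- 3 * (1 - pmf q y))) \<le> 1 + 1 / real k ^ 2"
proof -
  let ?d = "real k powr (- 3)"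
  have d: "?d = 1 / real k ^ 3"
    using assms by (simp add: powr_minus powr_numeral divide_simps)
  have "(\<Sum>y\<in>{1..k}. real k powr (- 3 * (1 - pmf q y)))
      \<le> (\<Sum>y\<in>{1..k}. pmf q y + (1 - pmf q y) * ?d)"
    using assms by (intro sum_mono powr_minus_le_chord) (auto simp: pmf_le_1)
  also have "\<dots> = (\<Sum>y\<in>{1..k}. pmf q y) * (1 - ?d) + real k * ?d"
    by (simp add: sum.distrib sum_subtractf sum_distrib_right[symmetric] algebra_simps)
  also have "\<dots> \<le> 1 * (1 - ?d) + real k * ?d"
  proof (intro add_right_mono mult_right_mono)
    \<comment> \<open>Only an inequality, as \<open>q\<close> may put mass outside
      \<open>{1..k}\<close>.\<close>
    show "(\<Sum>y\<in>{1..k}. pmf q y) \<le> 1"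
      by (simp add: measure_measure_pmf_finite[symmetric])
    show "0 \<le> 1 - ?d"
      using assms by (simp add: d)
  qed
  also have "\<dots> \<le> 1 + 1 / real k ^ 2"
    using assms by (simp add: d power2_eq_square power3_eq_cube)
  finally show ?thesis .
qed

lemma sum_weight_correct_le:
  assumes "k \<ge> 1"
  shows "(\<Sum>y\<in>{1..k}. weight k p (H @ [(x, True, y)])) \<le> (1 + 1 / real k ^ 2) * weight k p H"
proof -
  let ?w = "\<lambda>ys. real k powr (- 3 * predictor_loss p (zip (map fst H) ys))"
  have "(\<Sum>y\<in>{1..k}. weight k p (H @ [(x, True, y)]))
      = (\<Sum>ys\<in>fitting k H. ?w ys * (\<Sum>y\<in>{1..k}. real k powr (- 3 * (1 - pmf (p (zip (map fst H) ys) x) y))))"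
    by (simp add: weight_correct sum_distrib_left sum.swap[of _ "fitting k H"])
  also have "\<dots> \<le> (\<Sum>ys\<in>fitting k H. ?w ys * (1 + 1 / real k ^ 2))"
    using sum_powr_pmf_le[OF assms] by (intro sum_mono mult_left_mono) auto
  also have "\<dots> = (1 + 1 / real k ^ 2) * weight k p H"
    by (simp add: weight_def[of k p H] sum_distrib_left mult.commute)
  finally show ?thesis .
qed

section \<open>The charge per mistake and the commitment threshold\<close>

definition rate :: "nat \<Rightarrow> real" where
  "rate k = ln (real k) / (2 * real k)"

text \<open>The summand \<open>1 / k^2\<close> offsets the possible growth of the total weight, so
  that losing a share \<open>threshold k\<close> still leaves at most
  \<open>1 - rate k\<close>.\<close>

definition threshold :: "nat \<Rightarrow> real" where
  "threshold k = rate k + 1 / real k ^ 2"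

lemma rate_pos: "k \<ge> 2 \<Longrightarrow> rate k > 0"
  by (simp add: rate_def)

lemma threshold_pos: "k \<ge> 2 \<Longrightarrow> threshold k > 0"
  using rate_pos[of k] by (simp add: threshold_def add_pos_nonneg)

text \<open>This balances a uniform guess: one correct label changes \<open>ln W\<close> by at most
  \<open>ln (threshold k)\<close>, and each of the \<open>k - 1\<close> wrong ones costs at most
  \<open>threshold k\<close>, charge included.\<close>

lemma ln_threshold_le:
  assumes "k \<ge> 2"
  shows "ln (threshold k) + (real k - 1) * threshold k \<le> 0"
proof -
  define s where "s = real k * threshold k"
  have s: "s = ln (real k) / 2 + 1 / real k"
    using assms by (simp add: s_def threshold_def rate_def field_simps power2_eq_square)
  have s0: "s > 0"
    using assms threshold_pos[OF assms] by (simp add: s_def)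
  \<comment> \<open>It remains to see \<open>s - 1 - ln k \<le> - s\<close>. Since
    \<open>2 * s = ln k + 2 / k\<close>, this amounts to \<open>2 / k \<le> 1\<close>.\<close>
  have "ln s \<le> s - 1"
    using s0 by (rule ln_le_minus_one)
  moreover have "2 / real k \<le> 1"
    using assms by simp
  ultimately have "ln s - ln (real k) \<le> - s"
    using s by simp
  moreover have "ln (threshold k) = ln s - ln (real k)"
    using assms threshold_pos[OF assms] by (simp add: s_def ln_mult)
  ultimately show ?thesis
    using threshold_pos[OF assms] by (simp add: s_def algebra_simps)
qed

section \<open>The bandit learner and the drop of the log-weight in one round\<close>

text \<open>Several labels may reach the threshold; the analysis works for any of them, hence
  \<open>SOME\<close>.\<close>

definition bandit_learner ::
  "nat \<Rightarrow> (('x \<times> nat) list \<Rightarrow> 'x \<Rightarrow> nat pmf) \<Rightarrow> ('x \<times> bool \<times> nat) list \<Rightarrow> 'x \<Rightarrow> nat pmf" where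
  "bandit_learner k p H x =
     (if \<exists>y\<in>{1..k}. weight k p (H @ [(x, True, y)]) \<ge> threshold k * weight k p H
      then return_pmf (SOME y. y \<in> {1..k} \<and> weight k p (H @ [(x, True, y)]) \<ge> threshold k * weight k p H)
      else pmf_of_set {1..k})"

lemma bandit_learner_cases [consumes 1, case_names commit explore]:
  assumes "k \<ge> 1"
  obtains (commit) z where "z \<in> {1..k}" "threshold k * weight k p H \<le> weight k p (H @ [(x, True, z)])"
      "bandit_learner k p H x = return_pmf z"
  | (explore) "\<And>z. z \<in> {1..k} \<Longrightarrow> weight k p (H @ [(x, True, z)]) < threshold k * weight k p H"
      "bandit_learner k p H x = pmf_of_set {1..k}"
proof (cases "\<exists>y\<in>{1..k}. weight k p (H @ [(x, True, y)]) \<ge> threshold k * weight k p H")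
  case True
  then have "\<exists>y. y \<in> {1..k} \<and> weight k p (H @ [(x, True, y)]) \<ge> threshold k * weight k p H"
    by auto
  from someI_ex[OF this] True show ?thesis
    by (intro commit[of "SOME y. y \<in> {1..k} \<and> weight k p (H @ [(x, True, y)]) \<ge> threshold k * weight k p H"])
      (simp_all add: bandit_learner_def)
next
  case False
  then show ?thesis
    by (intro explore) (auto simp: bandit_learner_def not_le)
qed

lemma set_bandit_learner: "k \<ge> 1 \<Longrightarrow> set_pmf (bandit_learner k p H x) \<subseteq> {1..k}"
  by (cases rule: bandit_learner_cases[of k p H x]) auto

lemma weight_incorrect_pos:
  assumes "k \<ge> 2" "weight k p H > 0"
  shows "weight k p (H @ [(x, False, z)]) > 0"
proof -
  \<comment> \<open>With two labels or more, one of 1 and 2 differs from \<open>z\<close>.\<close>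
  have "\<exists>y. y \<in> {1..k} - {z}"
    using assms(1) by (intro exI[of _ "if z = 1 then 2 else 1"]) auto
  then show ?thesis
    unfolding weight_incorrect using assms(2) by (intro sum_pos weight_correct_pos) auto
qed

lemma weight_incorrect_le:
  assumes "k \<ge> 1" "z \<in> {1..k}"
  shows "weight k p (H @ [(x, False, z)])
     \<le> (1 + 1 / real k ^ 2) * weight k p H - weight k p (H @ [(x, True, z)])"
  using sum_weight_correct_le[OF assms(1), of p H x] assms(2)
  by (simp add: weight_incorrect sum_diff1)

text \<open>The first form is for a correct uniform guess, where the ratio is small; the linear
  second form is for mistakes, where the ratio is near 1 and the charge is additive.\<close>

lemma ln_le_ratio:
  fixes a b c :: real
  assumes "0 < a" "0 < b" "a \<le> c * b"
  shows "ln a \<le> ln b + ln c" "ln a \<le> ln b + (c - 1)"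
proof -
  have c: "c > 0"
    using assms by (metis less_le_trans zero_less_mult_pos2)
  show "ln a \<le> ln b + ln c"
    using assms c by (metis add.commute ln_mult_pos ln_mono)
  with ln_le_minus_one[OF c] show "ln a \<le> ln b + (c - 1)"
    by linarith
qed

text \<open>When some label carries a large share of the weight, a mistake on it removes that share.
  Otherwise a uniform guess is correct with probability 1/k and then removes almost all the weight.\<close>

lemma expected_ln_weight_le:
  assumes "k \<ge> 2" "weight k p H > 0" "y \<in> {1..k}"
  shows "(\<Sum>z\<in>{1..k}. pmf (bandit_learner k p H x) z *
      ((if z \<noteq> y then rate k else 0) + ln (weight k p (H @ [(x, z = y, z)])))) \<le> ln (weight k p H)"
proof -
  have k1: "k \<ge> 1"
    using assms(1) by simp
  let ?W = "weight k p H"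
  from k1 show ?thesis
  proof (cases rule: bandit_learner_cases[of k p H x])
    case (commit z)
    have "(if z \<noteq> y then rate k else 0) + ln (weight k p (H @ [(x, z = y, z)])) \<le> ln ?W"
    proof (cases "z = y")
      case True
      then show ?thesis
        using weight_correct_le[OF k1 assms(3), of p H x] weight_correct_pos[OF assms(3,2), of x] by simp
    next
      case False
      \<comment> \<open>The growth \<open>1 / k^2\<close> cancels against the same summand of
        \<open>threshold k\<close>; the remaining drop pays the charge
        \<open>rate k\<close>.\<close>
      have "weight k p (H @ [(x, False, z)]) \<le> (1 - rate k) * ?W"
        using weight_incorrect_le[OF k1 commit(1), of p H x] commit(2)
        by (simp add: threshold_def algebra_simps)
      from ln_le_ratio(2)[OF weight_incorrect_pos[OF assms(1,2)] assms(2) this] False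
      show ?thesis by simp
    qed
    then show ?thesis
      using commit(1) by (simp add: commit(3) pmf_return indicator_def if_distrib[of "\<lambda>a. a * _"] cong: if_cong)
  next
    case explore
    let ?f = "\<lambda>z. (if z \<noteq> y then rate k else 0) + ln (weight k p (H @ [(x, z = y, z)]))"
    have correct: "?f y \<le> ln ?W + ln (threshold k)"
      using ln_le_ratio(1)[OF weight_correct_pos[OF assms(3,2)] assms(2)] explore(1)[OF assms(3)]
      by fastforce
    have incorrect: "?f z \<le> ln ?W + threshold k" if "z \<in> {1..k} - {y}" for z
    proof -
      \<comment> \<open>The share removed with \<open>z\<close> is discarded. The growth
        \<open>1 / k^2\<close> and the charge \<open>rate k\<close> then add up to
        \<open>threshold k\<close>.\<close>
      have "weight k p (H @ [(x, False, z)]) \<le> (1 + 1 / real k ^ 2) * ?W"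
        using weight_incorrect_le[OF k1, of z p H x] weight_correct_pos[OF _ assms(2), of z x] that
        by fastforce
      from ln_le_ratio(2)[OF weight_incorrect_pos[OF assms(1,2)] assms(2) this] that
      show ?thesis by (simp add: threshold_def)
    qed
    have "(\<Sum>z\<in>{1..k}. ?f z) = ?f y + (\<Sum>z\<in>{1..k} - {y}. ?f z)"
      using assms(3) by (intro sum.remove) auto
    also have "\<dots> \<le> (ln ?W + ln (threshold k)) + (\<Sum>z\<in>{1..k} - {y}. ln ?W + threshold k)"
      by (rule add_mono[OF correct sum_mono[OF incorrect]])
    also have "\<dots> = real k * ln ?W + (ln (threshold k) + (real k - 1) * threshold k)"
      using assms(3) by (simp add: of_nat_diff algebra_simps)
    also have "\<dots> \<le> real k * ln ?W"
      using ln_threshold_le[OF assms(1)] by simp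
    finally have "(\<Sum>z\<in>{1..k}. ?f z) / real k \<le> ln ?W"
      using k1 by (simp add: divide_simps mult.commute)
    moreover have "(\<Sum>z\<in>{1..k}. pmf (bandit_learner k p H x) z * ?f z) = (\<Sum>z\<in>{1..k}. ?f z) / real k"
      unfolding sum_divide_distrib using k1
      by (intro sum.cong refl) (simp add: explore(2))
    ultimately show ?thesis by simp
  qed
qed

section \<open>The potential along the game\<close>

lemma ln_weight_ge:
  assumes "k \<ge> 1" "bandit_realizable P H" "\<forall>S\<in>P. \<forall>e\<in>set S. snd e \<in> {1..k}"
    and "\<And>S. S \<in> P \<Longrightarrow> predictor_loss p S \<le> m"
  shows "weight k p H > 0" "- 3 * m * ln (real k) \<le> ln (weight k p H)"
proof -
  from assms(2) obtain ys where ys: "labels_fit H ys" "zip (map fst H) ys \<in> P"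
    by (auto simp: bandit_realizable_def)
  \<comment> \<open>Labels of patterns in \<open>P\<close> lie in \<open>{1..k}\<close>, so the
    realizing labelling is among those counted by \<open>weight\<close>.\<close>
  have "set ys = snd ` set (zip (map fst H) ys)"
    using ys(1) by (metis labels_fit_def length_map list.set_map map_snd_zip)
  then have "ys \<in> fitting k H"
    using ys assms(3) by (fastforce simp: fitting_def)
  have "real k powr (- 3 * m) \<le> real k powr (- 3 * predictor_loss p (zip (map fst H) ys))"
    using assms(1) assms(4)[OF ys(2)] by (intro powr_mono) auto
  also have "\<dots> \<le> weight k p H"
    unfolding weight_def by (rule member_le_sum[OF \<open>ys \<in> fitting k H\<close>]) (auto intro: finite_fitting)
  finally have ge: "real k powr (- 3 * m) \<le> weight k p H" .
  moreover have "real k powr (- 3 * m) > 0"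
    using assms(1) by simp
  ultimately show "weight k p H > 0"
    by linarith
  have "- 3 * m * ln (real k) = ln (real k powr (- 3 * m))"
    using assms(1) by (simp add: ln_powr)
  also have "\<dots> \<le> ln (weight k p H)"
    using ge assms(1) by (intro ln_mono) auto
  finally show "- 3 * m * ln (real k) \<le> ln (weight k p H)" .
qed

text \<open>Appending \<open>y\<close> to the witnessing labels answers every prediction
  \<open>z\<close> with the feedback \<open>z = y\<close>. The earlier witnesses need not be the
  labels the adversary drew.\<close>

lemma extension_realizable_snoc:
  "extension_realizable P H x y \<Longrightarrow> bandit_realizable P (H @ [(x, z = y, z)])"
  unfolding extension_realizable_def bandit_realizable_def
proof (elim exE conjE)
  fix ys
  assume ys: "labels_fit H ys" "zip (map fst H) ys @ [(x, y)] \<in> P"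
  then have "length ys = length H"
    by (simp add: labels_fit_def)
  with ys show "\<exists>ys. labels_fit (H @ [(x, z = y, z)]) ys \<and> zip (map fst (H @ [(x, z = y, z)])) ys \<in> P"
    by (intro exI[of _ "ys @ [y]"]) (auto simp: labels_fit_snoc)
qed

text \<open>Fubini via the product \<open>pair_pmf\<close>: prediction and true label are drawn
  independently within a round, so the label can be fixed first.\<close>

lemma nn_integral_pmf_swap:
  fixes f :: "'a \<Rightarrow> 'b \<Rightarrow> ennreal"
  shows "(\<integral>\<^sup>+ a. \<integral>\<^sup>+ b. f a b \<partial>measure_pmf q \<partial>measure_pmf p) = (\<integral>\<^sup>+ b. \<integral>\<^sup>+ a. f a b \<partial>measure_pmf p \<partial>measure_pmf q)"
  using nn_integral_pair_pmf'[of p q "\<lambda>(a, b). f a b"] nn_integral_pair_pmf'[of q p "\<lambda>(b, a). f a b"]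
  by (simp add: pair_commute_pmf[of p q] case_prod_unfold)

text \<open>The bound is a potential that is nonnegative on realizable histories and drops in
  expectation by at least the mistake probability. It thus covers the remaining mistakes for every
  horizon \<open>T\<close>.\<close>

lemma bandit_mistakes_le:
  assumes "k \<ge> 2" "\<forall>S\<in>P. \<forall>e\<in>set S. snd e \<in> {1..k}"
    and m: "\<And>S. S \<in> P \<Longrightarrow> predictor_loss p S \<le> m"
    and "adversary_consistent P AX AT" "bandit_realizable P (bview h)"
  shows "bandit_mistakes (bandit_learner k p) AX AT T h
     \<le> ennreal ((ln (weight k p (bview h)) + 3 * m * ln (real k)) / rate k)"
  using assms(5)
proof (induction T arbitrary: h)
  case 0
  then show ?case by simp
next
  case (Suc T)
  let ?L = "bandit_learner k p"
  define \<Phi> where "\<Phi> H = (ln (weight k p H) + 3 * m * ln (real k)) / rate k" for H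
  have k1: "k \<ge> 1"
    using assms(1) by simp
  \<comment> \<open>\<open>ennreal\<close> sends negative reals to 0, so sums pass through it only
    with this bound.\<close>
  have \<Phi>_nonneg: "\<Phi> H \<ge> 0" if "bandit_realizable P H" for H
    unfolding \<Phi>_def using ln_weight_ge(2)[OF k1 that assms(2) m] rate_pos[OF assms(1)]
    by (intro divide_nonneg_pos) auto
  show ?case
  proof (cases "AX h")
    case None
    then show ?thesis by simp
  next
    case (Some x)
    let ?H = "bview h"
    let ?\<pi> = "?L ?H x"
    let ?\<tau> = "AT h x ?\<pi>"
    \<comment> \<open>The bound holds for each admissible true label separately, so it does not
      matter how the adversary mixes labels after seeing \<open>?\<pi>\<close>.\<close>
    have round: "(\<integral>\<^sup>+ z. (if z \<noteq> y then 1 else 0) + bandit_mistakes ?L AX AT T (h @ [(x, z, y)])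
        \<partial>measure_pmf ?\<pi>) \<le> ennreal (\<Phi> ?H)" if y: "y \<in> set_pmf ?\<tau>" for y
    proof -
      have ext: "extension_realizable P ?H x y"
        using assms(4) Some Suc.prems y by (auto simp: adversary_consistent_def)
      then have yk: "y \<in> {1..k}"
        using assms(2) by (force simp: extension_realizable_def)
      have real: "bandit_realizable P (?H @ [(x, z = y, z)])" for z
        by (rule extension_realizable_snoc[OF ext])
      have "(\<integral>\<^sup>+ z. (if z \<noteq> y then 1 else 0) + bandit_mistakes ?L AX AT T (h @ [(x, z, y)]) \<partial>measure_pmf ?\<pi>)
          \<le> (\<integral>\<^sup>+ z. ennreal ((if z \<noteq> y then 1 else 0) + \<Phi> (?H @ [(x, z = y, z)])) \<partial>measure_pmf ?\<pi>)"
      proof (rule nn_integral_mono)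
        fix z
        have "bview (h @ [(x, z, y)]) = ?H @ [(x, z = y, z)]"
          by (simp add: bview_def)
        then have "bandit_mistakes ?L AX AT T (h @ [(x, z, y)]) \<le> ennreal (\<Phi> (?H @ [(x, z = y, z)]))"
          using Suc.IH[of "h @ [(x, z, y)]"] real[of z] by (simp add: \<Phi>_def)
        then show "(if z \<noteq> y then 1 else 0) + bandit_mistakes ?L AX AT T (h @ [(x, z, y)])
            \<le> ennreal ((if z \<noteq> y then 1 else 0) + \<Phi> (?H @ [(x, z = y, z)]))"
          using \<Phi>_nonneg[OF real[of z]] by (auto simp: ennreal_plus add_left_mono)
      qed
      also have "\<dots> = (\<Sum>z\<in>{1..k}. ennreal ((if z \<noteq> y then 1 else 0) + \<Phi> (?H @ [(x, z = y, z)])) * ennreal (pmf ?\<pi> z))"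
        using set_bandit_learner[OF k1, of p ?H x] by (intro nn_integral_measure_pmf_support) auto
      also have "\<dots> = (\<Sum>z\<in>{1..k}. ennreal (pmf ?\<pi> z * ((if z \<noteq> y then 1 else 0) + \<Phi> (?H @ [(x, z = y, z)]))))"
        using \<Phi>_nonneg[OF real] by (intro sum.cong refl) (auto simp: ennreal_mult' mult.commute)
      also have "\<dots> = ennreal (\<Sum>z\<in>{1..k}. pmf ?\<pi> z * ((if z \<noteq> y then 1 else 0) + \<Phi> (?H @ [(x, z = y, z)])))"
        using \<Phi>_nonneg[OF real] by (intro sum_ennreal mult_nonneg_nonneg add_nonneg_nonneg) auto
      also have "\<dots> \<le> ennreal (\<Phi> ?H)"
      proof (rule ennreal_leI)
        have one: "(\<Sum>z\<in>{1..k}. pmf ?\<pi> z) = 1"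
          by (rule sum_pmf_eq_1[OF finite_atLeastAtMost set_bandit_learner[OF k1]])
        \<comment> \<open>Division by \<open>rate k\<close> turns the charge on \<open>ln W\<close>
          into one unit per mistake; the constant part survives averaging by
          \<open>one\<close>.\<close>
        have "(\<Sum>z\<in>{1..k}. pmf ?\<pi> z * ((if z \<noteq> y then 1 else 0) + \<Phi> (?H @ [(x, z = y, z)])))
          = (\<Sum>z\<in>{1..k}. pmf ?\<pi> z * ((if z \<noteq> y then rate k else 0) + ln (weight k p (?H @ [(x, z = y, z)]))) / rate k
               + pmf ?\<pi> z * (3 * m * ln (real k) / rate k))"
          using rate_pos[OF assms(1)] by (intro sum.cong refl) (auto simp: \<Phi>_def field_simps)
        also have "\<dots> = (\<Sum>z\<in>{1..k}. pmf ?\<pi> z * ((if z \<noteq> y then rate k else 0) + ln (weight k p (?H @ [(x, z = y, z)])))) / rate k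
               + 3 * m * ln (real k) / rate k"
          by (simp only: sum.distrib sum_divide_distrib[symmetric] sum_distrib_right[symmetric] one mult_1)
        also have "\<dots> \<le> ln (weight k p ?H) / rate k + 3 * m * ln (real k) / rate k"
          using expected_ln_weight_le[OF assms(1) ln_weight_ge(1)[OF k1 Suc.prems assms(2) m] yk, of x]
            rate_pos[OF assms(1)]
          by (intro add_right_mono divide_right_mono) auto
        finally show "(\<Sum>z\<in>{1..k}. pmf ?\<pi> z * ((if z \<noteq> y then 1 else 0) + \<Phi> (?H @ [(x, z = y, z)]))) \<le> \<Phi> ?H"
          by (simp add: \<Phi>_def add_divide_distrib)
      qed
      finally show ?thesis .
    qed
    have "bandit_mistakes ?L AX AT (Suc T) h =
      (\<integral>\<^sup>+ y. \<integral>\<^sup>+ z. (if z \<noteq> y then 1 else 0) + bandit_mistakes ?L AX AT T (h @ [(x, z, y)])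
         \<partial>measure_pmf ?\<pi> \<partial>measure_pmf ?\<tau>)"
      by (simp add: Some nn_integral_pmf_swap[where p = ?\<pi>])
    also have "\<dots> \<le> (\<integral>\<^sup>+ y. ennreal (\<Phi> ?H) \<partial>measure_pmf ?\<tau>)"
      using round by (intro nn_integral_mono_AE) (simp add: AE_measure_pmf_iff)
    finally show ?thesis
      by (simp add: \<Phi>_def)
  qed
qed

section \<open>Passing to the optimal values\<close>

lemma opt_bandit_adap_le:
  assumes "k \<ge> 2" "pattern_class P" "\<forall>S\<in>P. \<forall>e\<in>set S. snd e \<in> {1..k}"
    and "\<And>S. S \<in> P \<Longrightarrow> predictor_loss p S \<le> m"
  shows "opt_bandit_adap k P \<le> ennreal (6 * real k * m)"
proof -
  \<comment> \<open>The game starts from the empty history, where the weight is 1 and the potential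
    is \<open>3 * m * ln k / rate k = 6 * k * m\<close>.\<close>
  have "[] \<in> P"
    using assms(2) by (auto simp: pattern_class_def)
  then have "bandit_realizable P (bview [])"
    by (simp add: bandit_realizable_def bview_def labels_fit_def)
  then have "bandit_mistakes (bandit_learner k p) AX AT T [] \<le> ennreal (6 * real k * m)"
    if "adversary_consistent P AX AT" for AX AT T
    using bandit_mistakes_le[OF assms(1,3,4) that, of "[]" T] assms(1)
    by (simp add: bview_def rate_def mult_ac)
  then show ?thesis
    unfolding opt_bandit_adap_def using set_bandit_learner[of k p] assms(1)
    by (intro INF_lower2[of "bandit_learner k p"] SUP_least) auto
qed

theorem theorem5p1:
  fixes k :: nat and P :: "('x \<times> nat) list set"
  assumes "k \<ge> 2"
    and "pattern_class P"
    and "\<forall>S\<in>P. \<forall>e\<in>set S. snd e \<in> {1..k}"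
  shows "opt_bandit_adap k P \<le> of_nat (6 * k) * opt_full_rand k P"
proof -
  have k: "(of_nat (6 * k) :: ennreal) > 0"
    using assms(1) by (subst of_nat_0_less_iff) simp
  \<comment> \<open>With the factor divided out, the claim is a lower bound on an infimum and can be
    checked learner by learner.\<close>
  have "opt_bandit_adap k P / of_nat (6 * k) \<le> (SUP S \<in> P. full_mistakes L S [])" for L
  proof (cases "(SUP S \<in> P. full_mistakes L S [])")
    \<comment> \<open>A finite supremum is a real loss bound for the averaged predictor; an infinite
      one makes the inequality trivial.\<close>
    case (real m)
    have "predictor_loss (marginal_predictor L) S \<le> m" if "S \<in> P" for S
    proof -
      have "ennreal (predictor_loss (marginal_predictor L) S) \<le> ennreal m"
        unfolding real(2)[symmetric] full_mistakes_eq_predictor_loss[symmetric]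
        using that by (rule SUP_upper)
      then show ?thesis
        using real(1) by simp
    qed
    from opt_bandit_adap_le[OF assms this] have "opt_bandit_adap k P \<le> of_nat (6 * k) * ennreal m"
      using real(1) by (simp add: ennreal_mult ennreal_of_nat_eq_real_of_nat)
    then show ?thesis
      using divide_le_posI_ennreal[OF k] real(2) by simp
  next
    case top
    then show ?thesis by (simp only: top_greatest)
  qed
  then have "opt_bandit_adap k P / of_nat (6 * k) \<le> opt_full_rand k P"
    unfolding opt_full_rand_def by (intro INF_greatest)
  then have "of_nat (6 * k) * (opt_bandit_adap k P / of_nat (6 * k)) \<le> of_nat (6 * k) * opt_full_rand k P"
    by (rule mult_left_mono) simp
  moreover have "of_nat (6 * k) * (opt_bandit_adap k P / of_nat (6 * k)) = opt_bandit_adap k P"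
    using k by (simp add: ennreal_times_divide mult_divide_eq_ennreal mult.commute[of "of_nat (6 * k)"] del: of_nat_mult)
  ultimately show ?thesis by simp
qed

end
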